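(* Let $m\ge n\ge 1$ be integers with $m+n\equiv 0\pmod 2$. Then $$\int_0^\infty\frac{\tanh^m x}{x^n\cosh x}\,dx=\frac{2^n}{(n-1)!}\,\mathcal U_\beta\!\left((-B)^n q_m(B)\right).$$
   Context: The polynomials $q_m(x)$, $m\ge0$, are defined by the formal power series identity in $t$ $$\sum_{m=0}^{\infty}q_m(x)t^m=\frac{1}{\sqrt{1-t^2}}\exp\bigl(2x\operatorname{artanh}t\bigr)=(1+t)^{x-1/2}(1-t)^{-x-1/2}.$$ Let $\beta(s)=\sum_{k\ge0}(-1)^k(2k+1)^{-s}$ be the Dirichlet beta function. For positive even integers $k$ put $$b_k:=(-1)^{k/2}(k-1)!\,\frac{\beta(k)}{\pi^{k-1}}.$$ $\mathcal U_\beta$ denotes the linear evaluation map, defined on the real span of the monomials $B^k$ with $k\ge2$ even ($B$ an indeterminate), given by $\mathcal U_\beta(B^k)=b_k$. (For $m\equiv n\pmod2$ and $n\ge1$, only even powers $B^k$ with $k\ge2$ occur in $(-B)^nq_m(B)$, because every power $x^r$ occurring in $q_m(x)$ has $r\equiv m\pmod 2$.) Explicitly, the right-hand side of the claim means $$\frac{2^n}{(n-1)!}(-1)^n\sum_{0\le r\le m,\ r\equiv m\ (\mathrm{mod}\ 2)}d_{m,r}\,b_{n+r},\qquad d_{m,r}=[x^r]q_m(x),$$ where $[x^r]q_m(x)$ is the coefficient of $x^r$ in $q_m(x)$. *)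

theory Defs
  imports "HOL-Analysis.Analysis"
begin

definition fps_artanh :: "real fps" where
  "fps_artanh = Abs_fps (\<lambda>k. if odd k then 1 / real k else 0)"

text \<open>
  \<open>q_gen x\<close> is the formal power series \<open>(1 - t\<^sup>2) powr (- 1/2) * exp (2 x artanh t)\<close> in \<open>t\<close>,
  for a fixed real \<open>x\<close>.
\<close>

definition q_gen :: "real \<Rightarrow> real fps" where
  "q_gen x = (fps_binomial (- 1 / 2) oo (- (fps_X ^ 2))) * (fps_exp (2 * x) oo fps_artanh)"

text \<open>
  A real polynomial is determined by its values on the reals; existence is shown in
  \<open>poly_q_poly\<close> below.
\<close>

definition q_poly :: "nat \<Rightarrow> real poly" where
  "q_poly m = (THE p. \<forall>x. poly p x = fps_nth (q_gen x) m)"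

definition dirichlet_beta :: "real \<Rightarrow> real" where
  "dirichlet_beta s = (\<Sum>k. (- 1) ^ k * (2 * real k + 1) powr (- s))"

text \<open>Only meaningful for even \<open>k \<ge> 2\<close>.\<close>

definition b_val :: "nat \<Rightarrow> real" where
  "b_val k = (- 1) ^ (k div 2) * fact (k - 1) * (dirichlet_beta (real k) / pi ^ (k - 1))"

text \<open>
  The indeterminate \<open>B\<close> is that of \<^typ>\<open>real poly\<close>. The intended domain of \<open>U_beta\<close> is the
  span of the monomials of even degree \<open>\<ge> 2\<close>, called \<open>U_domain\<close>; outside of it, \<open>U_beta\<close>
  is an arbitrary linear extension.
\<close>

definition U_domain :: "real poly set" where
  "U_domain = {p. \<forall>k. coeff p k \<noteq> 0 \<longrightarrow> even k \<and> k \<ge> 2}"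

definition U_beta :: "real poly \<Rightarrow> real" where
  "U_beta p = (\<Sum>k\<le>degree p. coeff p k * b_val k)"

lemma U_beta_eq:
  assumes "degree p \<le> N"
  shows "U_beta p = (\<Sum>k\<le>N. coeff p k * b_val k)"
  unfolding U_beta_def
  by (rule sum.mono_neutral_left) (use assms in \<open>auto simp: coeff_eq_0\<close>)

lemma U_beta_add: "U_beta (p + r) = U_beta p + U_beta r"
proof -
  define N where "N = max (degree p) (degree r)"
  have "degree (p + r) \<le> N" "degree p \<le> N" "degree r \<le> N"
    by (auto simp: N_def degree_add_le_max)
  thus ?thesis
    by (simp add: U_beta_eq[where N = N] sum.distrib algebra_simps)
qed

lemma U_beta_smult: "U_beta (smult c p) = c * U_beta p"
  by (subst U_beta_eq[where N = "degree p"])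
     (auto simp: U_beta_def sum_distrib_left mult.assoc)

lemma U_beta_monom: "U_beta (monom 1 k) = b_val k"
  by (subst U_beta_eq[where N = k]) (auto simp: degree_monom_eq if_distrib[of "\<lambda>x. x * _"] cong: if_cong)

lemma poly_q_poly: "poly (q_poly m) x = fps_nth (q_gen x) m"
proof -
  define S where "S = fps_binomial (- 1 / 2) oo (- (fps_X ^ 2 :: real fps))"
  define p where "p = (\<Sum>i=0..m. \<Sum>j=0..m - i. monom (fps_nth S i * 2 ^ j / fact j * (fps_nth (fps_artanh ^ j) (m - i))) j)"
  have p: "poly p x = fps_nth (q_gen x) m" for x
  proof -
    have "fps_nth (fps_exp (2 * x) oo fps_artanh) k
        = (\<Sum>j=0..k. 2 ^ j / fact j * fps_nth (fps_artanh ^ j) k * x ^ j)" for k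
      by (simp add: fps_compose_nth power_mult_distrib mult_ac)
    thus ?thesis
      unfolding p_def q_gen_def S_def[symmetric] fps_mult_nth
      by (simp add: poly_sum poly_monom sum_distrib_left mult_ac)
  qed
  have "q_poly m = p"
    unfolding q_poly_def
  proof (rule the_equality)
    show "\<forall>x. poly p x = fps_nth (q_gen x) m" using p by blast
    fix r assume "\<forall>x. poly r x = fps_nth (q_gen x) m"
    hence "poly r = poly p" using p by auto
    thus "r = p" by (simp add: poly_eq_poly_eq_iff)
  qed
  thus ?thesis using p by simp
qed

lemma q_poly_gen: "Abs_fps (\<lambda>m. poly (q_poly m) x) = q_gen x"
  by (simp add: fps_eq_iff poly_q_poly)

lemma fps_ODE_unique_aux:
  fixes f g h :: "real fps"
  assumes f: "(1 - fps_X ^ 2) * fps_deriv f = h * f" and g: "(1 - fps_X ^ 2) * fps_deriv g = h * g"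
    and f0: "fps_nth f 0 = 1" and g0: "fps_nth g 0 = 1"
  shows "f = g"
proof -
  have "fps_nth (1 - fps_X ^ 2 :: real fps) 0 \<noteq> 0" by simp
  hence nz: "(1 - fps_X ^ 2 :: real fps) \<noteq> 0" by (metis fps_zero_nth)
  have "(1 - fps_X ^ 2) * (fps_deriv f * g - f * fps_deriv g) = 0"
  proof -
    have "(1 - fps_X ^ 2) * (fps_deriv f * g - f * fps_deriv g)
        = ((1 - fps_X ^ 2) * fps_deriv f) * g - f * ((1 - fps_X ^ 2) * fps_deriv g)"
      by (simp only: right_diff_distrib mult_ac)
    also have "\<dots> = 0" unfolding f g by (simp only: mult_ac diff_self)
    finally show ?thesis .
  qed
  hence eq: "fps_deriv f * g = f * fps_deriv g" using nz by simp
  have gi: "inverse g * g = 1" using g0 by (simp add: inverse_mult_eq_1)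
  have "fps_deriv (f * inverse g) = (fps_deriv f * g - f * fps_deriv g) * inverse g ^ 2"
  proof -
    have "fps_deriv (f * inverse g) = f * (- fps_deriv g * inverse g ^ 2) + fps_deriv f * inverse g"
      using g0 by (simp add: fps_inverse_deriv)
    also have "fps_deriv f * inverse g = fps_deriv f * (inverse g * g) * inverse g"
      unfolding gi by simp
    also have "f * (- fps_deriv g * inverse g ^ 2) + \<dots>
        = (fps_deriv f * g - f * fps_deriv g) * inverse g ^ 2"
      by (simp add: power2_eq_square left_diff_distrib right_diff_distrib mult_ac)
    finally show ?thesis .
  qed
  hence "fps_deriv (f * inverse g) = fps_deriv 1" using eq by simp
  hence "f * inverse g = 1" unfolding fps_deriv_eq_iff using f0 g0 by simp
  thus ?thesis using gi by (metis mult.assoc mult.commute mult_1)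
qed

lemma fps_binomial_ODE: "(1 + fps_X) * fps_deriv (fps_binomial (c::real)) = fps_const c * fps_binomial c"
proof -
  have "fps_nth (1 + fps_X :: real fps) 0 \<noteq> 0" by simp
  thus ?thesis by (simp add: fps_binomial_deriv fps_divide_unit inverse_mult_eq_1' mult.left_commute)
qed

lemma fps_binomial_ODE_compose:
  assumes "fps_nth g 0 = (0::real)"
  shows "(1 + g) * (fps_deriv (fps_binomial c) oo g) = fps_const c * (fps_binomial c oo g)"
  using arg_cong[OF fps_binomial_ODE[of c], of "\<lambda>f. f oo g"] assms
  by (simp add: fps_compose_mult_distrib fps_compose_add_distrib)

lemma q_gen_ODE: "(1 - fps_X ^ 2) * fps_deriv (q_gen x) = (fps_const (2 * x) + fps_X) * q_gen x"
proof -
  define S where "S = fps_binomial (- 1 / 2) oo (- (fps_X ^ 2 :: real fps))"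
  define S' where "S' = fps_deriv (fps_binomial (- 1 / 2)) oo (- (fps_X ^ 2 :: real fps))"
  define K where "K = fps_exp (2 * x) oo fps_artanh"
  have S': "(1 - fps_X ^ 2) * S' = fps_const (- 1 / 2) * S"
    using fps_binomial_ODE_compose[of "- (fps_X ^ 2)" "- 1 / 2"] by (simp add: S_def S'_def)
  have "fps_deriv S = S' * (- (fps_const 2 * fps_X))"
    unfolding S_def S'_def by (subst fps_compose_deriv) (auto simp: fps_deriv_power numeral_fps_const)
  hence "(1 - fps_X ^ 2) * fps_deriv S = ((1 - fps_X ^ 2) * S') * (- (fps_const 2 * fps_X))"
    by (simp add: mult_ac)
  also have "\<dots> = (fps_const (- 1 / 2) * fps_const (- 2)) * (fps_X * S)"
    unfolding S' by (simp add: mult_ac flip: fps_const_neg)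
  finally have S: "(1 - fps_X ^ 2) * fps_deriv S = fps_X * S" by simp
  have art: "(1 - fps_X ^ 2) * fps_deriv fps_artanh = 1"
  proof (rule fps_ext)
    have d: "fps_nth (fps_deriv fps_artanh) k = (if even k then 1 else 0)" for k
      by (simp add: fps_artanh_def)
    fix k show "fps_nth ((1 - fps_X ^ 2) * fps_deriv fps_artanh) k = fps_nth 1 k"
      by (cases "k < 2")
         (auto simp: d left_diff_distrib fps_X_power_mult_nth less_2_cases_iff simp del: fps_deriv_nth)
  qed
  have "fps_deriv K = (fps_const (2 * x) * K) * fps_deriv fps_artanh"
    unfolding K_def
    by (subst fps_compose_deriv) (auto simp: fps_artanh_def fps_const_mult_apply_left)
  hence K: "(1 - fps_X ^ 2) * fps_deriv K = fps_const (2 * x) * K"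
    using art by (metis mult.left_commute mult.right_neutral)
  have "(1 - fps_X ^ 2) * fps_deriv (S * K) = ((1 - fps_X ^ 2) * fps_deriv S) * K + S * ((1 - fps_X ^ 2) * fps_deriv K)"
    by (simp add: algebra_simps)
  also have "\<dots> = (fps_const (2 * x) + fps_X) * (S * K)"
    unfolding S K by (simp add: algebra_simps)
  finally show ?thesis by (simp only: q_gen_def S_def K_def)
qed

lemma q_gen_eq: "q_gen x = fps_binomial (x - 1 / 2) * (fps_binomial (- x - 1 / 2) oo (- fps_X))"
proof (rule fps_ODE_unique_aux[OF q_gen_ODE])
  define F where "F = fps_binomial (x - 1 / 2)"
  define G where "G = fps_binomial (- x - 1 / 2) oo (- fps_X)"
  have F: "(1 + fps_X) * fps_deriv F = fps_const (x - 1 / 2) * F"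
    unfolding F_def by (rule fps_binomial_ODE)
  have G: "(1 - fps_X) * fps_deriv G = fps_const (x + 1 / 2) * G"
  proof -
    have "fps_deriv G = - (fps_deriv (fps_binomial (- x - 1 / 2)) oo (- fps_X))"
      unfolding G_def by (subst fps_compose_deriv) auto
    moreover have "(1 - fps_X) * (fps_deriv (fps_binomial (- x - 1 / 2)) oo (- fps_X)) = fps_const (- x - 1 / 2) * G"
      using fps_binomial_ODE_compose[of "- fps_X" "- x - 1 / 2"] by (simp add: G_def)
    ultimately have "(1 - fps_X) * fps_deriv G = - (fps_const (- x - 1 / 2) * G)" by simp
    also have "\<dots> = fps_const (- (- x - 1 / 2)) * G" by (simp only: fps_const_neg[symmetric] mult_minus_left)
    finally show ?thesis by simp
  qed
  have "(1 - fps_X ^ 2) * fps_deriv (F * G)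
      = (1 - fps_X) * ((1 + fps_X) * fps_deriv F) * G + (1 + fps_X) * F * ((1 - fps_X) * fps_deriv G)"
    by (simp add: algebra_simps power2_eq_square)
  also have "\<dots> = ((1 - fps_X) * fps_const (x - 1 / 2) + (1 + fps_X) * fps_const (x + 1 / 2)) * (F * G)"
    unfolding F G by (simp add: algebra_simps)
  also have "(1 - fps_X) * fps_const (x - 1 / 2) + (1 + fps_X) * fps_const (x + 1 / 2)
      = fps_const (2 * x) + fps_X"
    by (rule fps_ext) (auto simp: algebra_simps fps_X_def)
  finally show "(1 - fps_X ^ 2) * fps_deriv (fps_binomial (x - 1 / 2) * (fps_binomial (- x - 1 / 2) oo (- fps_X)))
     = (fps_const (2 * x) + fps_X) * (fps_binomial (x - 1 / 2) * (fps_binomial (- x - 1 / 2) oo (- fps_X)))"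
    by (simp add: F_def G_def)
qed (auto simp: q_gen_def)

lemma coeff_q_poly_eq_0: 
  assumes "odd (m + r)"
  shows "coeff (q_poly m) r = 0"
proof -
  have refl: "q_gen (- x) = q_gen x oo (- fps_X)" for x
    by (simp add: q_gen_eq fps_compose_mult_distrib fps_compose_assoc[symmetric] fps_compose_uminus mult.commute)
  have "poly (pcompose (q_poly m) [:0, -1:]) x = poly (smult ((-1) ^ m) (q_poly m)) x" for x
    by (simp add: poly_pcompose poly_q_poly refl fps_compose_uminus')
  hence "pcompose (q_poly m) [:0, -1:] = smult ((-1) ^ m) (q_poly m)"
    by (simp add: poly_eq_poly_eq_iff[symmetric] fun_eq_iff)
  hence "coeff (pcompose (q_poly m) [:0, -1:]) r = (-1) ^ m * coeff (q_poly m) r" by simp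
  moreover have "coeff (pcompose (q_poly m) [:0, -1:]) r = (-1) ^ r * coeff (q_poly m) r"
    by (simp add: coeff_pcompose_linear)
  ultimately show ?thesis using assms by (cases "even m") auto
qed

lemma U_beta_argument_in_domain:
  assumes "n \<ge> 1" "even (m + n)"
  shows "(- [:0, 1:]) ^ n * q_poly m \<in> U_domain"
proof -
  have e: "(- [:0, 1:]) ^ n * q_poly m = smult ((-1) ^ n) (monom 1 n * q_poly m)"
  proof -
    have "(- [:0, 1:]) ^ n = (smult (-1) [:0, 1:] :: real poly) ^ n" by simp
    also have "\<dots> = smult ((-1) ^ n) (monom 1 n)"
      by (simp only: smult_power monom_altdef smult_1_left)
    finally show ?thesis by (simp only: mult_smult_left)
  qed
  show ?thesis
    unfolding U_domain_def e
  proof safe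
    fix k assume k: "coeff (smult ((-1) ^ n) (monom 1 n * q_poly m)) k \<noteq> 0"
    hence nk: "n \<le> k" and c: "coeff (q_poly m) (k - n) \<noteq> 0"
      by (auto simp: coeff_monom_mult split: if_splits)
    have "even (m + (k - n))" using coeff_q_poly_eq_0 c by blast
    thus "even k" using assms nk by presburger
    thus "k \<ge> 2" using assms nk by presburger
  qed
qed

end

(*
  Applying the ODE of the generating function coefficientwise gives
  (m + 1) q_{m+1} = 2 x q_m + m q_{m-1}. This is the recurrence satisfied by (-1)^m tanh^m sech
  under D = d/dx, so q_m(D/2) sech = (-1)^m tanh^m sech. It is also the recurrence that integration
  by parts yields for the integrals in the theorem, which reduces the claim to n = 1. For n = 1 the
  operator identity leaves the integrals of sech^(r)(x) / x over (0, oo) for odd r. The reflection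
  formula of the digamma function writes sech, and hence its derivatives, as polygamma series;
  integrating termwise with
    int_0^oo Im ((a + i x)^(-s)) / x dx = - pi / (2 a^s)
  gives 2^(r+1) b_(r+1).
*)
theory Submission
  imports Defs
begin

subsection \<open>Derivatives of the hyperbolic secant as polygamma values\<close>

text \<open>The obstacle is the factor 1/x: the r-th derivative of sech divided by x is integrable
  at 0 only if that derivative vanishes there, which happens exactly for odd r. For n = 1 the
  exponent m is odd and q_m has odd powers only, so no other r occurs. The beta values arise because
  the r-th derivative of sech is a sum of imaginary parts of powers of 1 / (a + i x) with a = 2 pi
  (k + 3/4) or 2 pi (k + 1/4), that is, pi/2 times an odd integer. Since each such summand over x
  integrates to a multiple of 1 / a^(r+1), the residues 1 and 3 modulo 4 yield the two signs of the
  alternating beta series.\<close>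

lemma Digamma_reflection_complex:
  fixes z :: complex
  assumes z: "z \<notin> \<int>"
  shows "Digamma (1 - z) - Digamma z = of_real pi * cot (of_real pi * z)"
proof -
  have z': "1 - z \<notin> \<int>" using z by (metis Ints_1 Ints_diff diff_diff_eq2 add_diff_cancel_left')
  have nonpos: "z \<notin> \<int>\<^sub>\<le>\<^sub>0" "1 - z \<notin> \<int>\<^sub>\<le>\<^sub>0" using z z' nonpos_Ints_subset_Ints by auto
  have sin: "sin (of_real pi * z) \<noteq> 0" using z by (subst sin_eq_0) (auto simp: mult.commute)
  \<comment> \<open>The two sides of Euler's reflection formula are differentiated separately;
    uniqueness of the derivative and cancellation of the nonzero product give the claim.\<close>
  have "((\<lambda>w. Gamma w * Gamma (1 - w)) has_field_derivative
          Gamma z * Gamma (1 - z) * (Digamma z - Digamma (1 - z))) (at z)"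
    using nonpos by (auto intro!: derivative_eq_intros simp: algebra_simps)
  moreover have "((\<lambda>w. Gamma w * Gamma (1 - w)) has_field_derivative
          - (of_real pi * of_real pi * cos (of_real pi * z)) / sin (of_real pi * z) ^ 2) (at z)"
    unfolding Gamma_reflection_complex
    using sin by (auto intro!: derivative_eq_intros simp: power2_eq_square mult_ac)
  ultimately have "Gamma z * Gamma (1 - z) * (Digamma z - Digamma (1 - z)) =
      - (of_real pi * of_real pi * cos (of_real pi * z)) / sin (of_real pi * z) ^ 2"
    by (rule DERIV_unique)
  also have "\<dots> = of_real pi / sin (of_real pi * z) * (- (of_real pi * cot (of_real pi * z)))"
    using sin by (simp add: cot_def power2_eq_square)
  finally have "Digamma z - Digamma (1 - z) = - (of_real pi * cot (of_real pi * z))"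
    unfolding Gamma_reflection_complex using sin by (subst (asm) mult_left_cancel) auto
  thus ?thesis by (simp add: algebra_simps)
qed

text \<open>The defining series has real coefficients, so conjugation acts termwise.\<close>

lemma cnj_Digamma:
  assumes "z \<noteq> 0"
  shows "cnj (Digamma z) = Digamma (cnj z)"
proof -
  have "(\<lambda>k. cnj (inverse (of_nat (Suc k)) - inverse (z + of_nat k))) sums
        cnj (\<Sum>k. inverse (of_nat (Suc k)) - inverse (z + of_nat k))"
    using summable_sums[OF summable_Digamma[OF assms]] by (simp only: sums_cnj)
  thus ?thesis
    by (simp add: Digamma_def sums_iff euler_mascheroni_def)
qed

text \<open>On the line Re z = pi/4 the real sine and cosine coincide. Hence Re (cos z * cnj (sin
  z)) collapses to (cosh^2 - sinh^2) / 2, and |sin z|^2 becomes (cosh^2 + sinh^2) / 2, a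
  double-angle value.\<close>

lemma Re_cot_quarter_pi: "Re (cot (of_real (pi / 4) + \<i> * of_real v)) = 1 / cosh (2 * v)"
proof -
  define z where "z = complex_of_real (pi / 4) + \<i> * of_real v"
  have 1: "Re (sin z) = sqrt 2 / 2 * cosh v" "Im (sin z) = sqrt 2 / 2 * sinh v"
    "Re (cos z) = sqrt 2 / 2 * cosh v" "Im (cos z) = - (sqrt 2 / 2 * sinh v)"
    by (simp_all add: z_def Re_sin Im_sin Re_cos Im_cos sin_45 cos_45 cosh_field_def sinh_field_def field_simps)
  have "Re (cos z) * Re (sin z) + Im (cos z) * Im (sin z) = (cosh v ^ 2 - sinh v ^ 2) / 2"
    unfolding 1 by (simp add: power2_eq_square algebra_simps)
  also have "\<dots> = 1 / 2" by (simp add: cosh_square_eq)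
  finally have 2: "Re (cos z) * Re (sin z) + Im (cos z) * Im (sin z) = 1 / 2" .
  have 3: "Re (sin z) ^ 2 + Im (sin z) ^ 2 = cosh (2 * v) / 2"
    unfolding 1 cosh_double by (simp add: power_mult_distrib power_divide)
  show ?thesis
    unfolding cot_def z_def[symmetric] Re_divide 2 3 by simp
qed

text \<open>
  The closed form of the \<open>r\<close>-th derivative of the hyperbolic secant: by reflection,
  \<open>\<pi> sech x = Re (\<psi>(3/4 + i x / 2\<pi>) - \<psi>(1/4 + i x / 2\<pi>))\<close>.
\<close>

definition sech_deriv :: "nat \<Rightarrow> real \<Rightarrow> real" where
  "sech_deriv r x = Re ((\<i> / (2 * of_real pi)) ^ r *
     (Polygamma r (Complex (3/4) (x / (2 * pi))) - Polygamma r (Complex (1/4) (x / (2 * pi))))) / pi"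

lemma sech_deriv_0: "sech_deriv 0 x = 1 / cosh x"
proof -
  define u where "u = x / (2 * pi)"
  have "Complex (1/4) u \<notin> \<int>"
  proof
    assume "Complex (1/4) u \<in> \<int>"
    then obtain k where "Complex (1/4) u = of_int k" by (elim Ints_cases)
    hence "real_of_int (4 * k) = of_int 1" by (simp add: complex_eq_iff)
    thus False unfolding of_int_eq_iff by presburger
  qed
  hence "Digamma (1 - Complex (1/4) u) - Digamma (Complex (1/4) u) =
         of_real pi * cot (of_real pi * Complex (1/4) u)"
    by (rule Digamma_reflection_complex)
  \<comment> \<open>The reflected value is thus the conjugate of the one at 3/4 + i u. Taking real
    parts removes the conjugation and leaves the difference in \<open>sech_deriv\<close>.\<close>
  moreover have "1 - Complex (1/4) u = cnj (Complex (3/4) u)"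
    by (simp add: complex_eq_iff)
  moreover have "of_real pi * Complex (1/4) u = of_real (pi / 4) + \<i> * of_real (x / 2)"
    by (simp add: complex_eq_iff u_def)
  moreover have "Digamma (cnj (Complex (3/4) u)) = cnj (Digamma (Complex (3/4) u))"
    by (rule cnj_Digamma[symmetric]) (simp add: complex_eq_iff)
  ultimately have "cnj (Digamma (Complex (3/4) u)) - Digamma (Complex (1/4) u) =
      of_real pi * cot (of_real (pi / 4) + \<i> * of_real (x / 2))"
    by (simp only:)
  from arg_cong[OF this, of Re] show ?thesis
    using Re_cot_quarter_pi[of "x / 2"] by (simp add: sech_deriv_def u_def)
qed

text \<open>Moving along a vertical line at speed 1 / (2 pi) contributes the chain rule factor i /
  (2 pi), the new power in the next \<open>sech_deriv\<close>. Both lines lie in the right half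
  plane, away from the poles.\<close>

lemma has_field_derivative_sech_deriv:
  "(sech_deriv r has_field_derivative sech_deriv (Suc r) x) (at x)"
proof -
  define c where "c = \<i> / (2 * of_real pi)"
  have 1: "((\<lambda>x. Polygamma r (Complex a (x / (2 * pi)))) has_vector_derivative
          c * Polygamma (Suc r) (Complex a (x / (2 * pi)))) (at x)" if "a > 0" for a
  proof -
    have eq: "Complex a (x / (2 * pi)) = of_real a + c * of_real x" for x
      by (simp add: complex_eq_iff c_def)
    have "of_real a + c * of_real x \<notin> \<int>\<^sub>\<le>\<^sub>0"
      using that by (auto simp: c_def elim!: nonpos_Ints_cases dest!: arg_cong[of _ _ Re])
    hence "((\<lambda>w. Polygamma r (of_real a + c * w)) has_field_derivative
         Polygamma (Suc r) (of_real a + c * of_real x) * c) (at (of_real x))"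
      by (auto intro!: derivative_eq_intros)
    from has_vector_derivative_real_field[OF this] show ?thesis unfolding eq by (simp only: mult.commute)
  qed
  have "((\<lambda>x. c ^ r * (Polygamma r (Complex (3/4) (x / (2 * pi))) - Polygamma r (Complex (1/4) (x / (2 * pi)))))
     has_vector_derivative
     c ^ r * (c * Polygamma (Suc r) (Complex (3/4) (x / (2 * pi))) - c * Polygamma (Suc r) (Complex (1/4) (x / (2 * pi))))) (at x)"
    by (intro has_vector_derivative_mult_right has_vector_derivative_diff 1) auto
  from bounded_linear.has_vector_derivative[OF bounded_linear_Re this]
  have "((\<lambda>x. Re (c ^ r * (Polygamma r (Complex (3/4) (x / (2 * pi))) - Polygamma r (Complex (1/4) (x / (2 * pi))))))
     has_field_derivative
     Re (c ^ Suc r * (Polygamma (Suc r) (Complex (3/4) (x / (2 * pi))) - Polygamma (Suc r) (Complex (1/4) (x / (2 * pi)))))) (at x)"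
    unfolding has_real_derivative_iff_has_vector_derivative by (simp only: power_Suc right_diff_distrib mult_ac)
  from DERIV_cdivide[OF this, of pi] show ?thesis
    unfolding sech_deriv_def c_def by simp
qed

subsection \<open>The operator identity for the polynomials \<open>q_m\<close>\<close>

lemma q_poly_Suc:
  "smult (real (Suc m)) (q_poly (Suc m)) =
     smult 2 (pCons 0 (q_poly m)) + smult (real m) (q_poly (m - 1))"
proof -
  have "poly (smult (real (Suc m)) (q_poly (Suc m))) x =
        poly (smult 2 (pCons 0 (q_poly m)) + smult (real m) (q_poly (m - 1))) x" for x
  proof -
    have "fps_nth ((1 - fps_X ^ 2) * fps_deriv (q_gen x)) m =
          fps_nth ((fps_const (2 * x) + fps_X) * q_gen x) m"
      by (simp only: q_gen_ODE)
    thus ?thesis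
      \<comment> \<open>The coefficient of t^m is (m+1) q_{m+1} - (m-1) q_{m-1} on the left and 2 x
        q_m + q_{m-1} on the right. The cases m = 0 and m = 1 are those where the shift by t^2 runs
        out of coefficients; at m = 0 the truncated index \<open>m - 1\<close> carries the factor
        0.\<close>
      by (cases m; cases "m - 1")
        (auto simp: poly_q_poly left_diff_distrib distrib_right fps_X_power_mult_nth 
           less_2_cases_iff algebra_simps numeral_2_eq_2)
  qed
  thus ?thesis by (simp add: poly_eq_poly_eq_iff[symmetric] fun_eq_iff)
qed

lemma q_poly_0: "q_poly 0 = 1"
proof -
  have "poly (q_poly 0) x = poly 1 x" for x
    by (simp add: poly_q_poly q_gen_def)
  thus ?thesis by (simp add: poly_eq_poly_eq_iff[symmetric] fun_eq_iff)
qed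

text \<open>The umbral substitution of c k for the k-th power. The choice c = \<open>b_val\<close>
  gives \<open>U_beta\<close>, and c r = \<open>sech_deriv r x / 2 ^ r\<close> gives p(D/2) sech at
  x, so both uses of the recurrence share one calculus.\<close>

definition coeff_pairing :: "(nat \<Rightarrow> real) \<Rightarrow> real poly \<Rightarrow> real" where
  "coeff_pairing c p = (\<Sum>k\<le>degree p. coeff p k * c k)"

lemma coeff_pairing_eq:
  assumes "degree p \<le> N"
  shows "coeff_pairing c p = (\<Sum>k\<le>N. coeff p k * c k)"
  unfolding coeff_pairing_def
  by (rule sum.mono_neutral_left) (use assms in \<open>auto simp: coeff_eq_0\<close>)

lemma coeff_pairing_add: "coeff_pairing c (p + r) = coeff_pairing c p + coeff_pairing c r"
  using coeff_pairing_eq[where N = "max (degree p) (degree r)" and c = c]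
  by (simp add: degree_add_le_max sum.distrib algebra_simps)

lemma coeff_pairing_smult: "coeff_pairing c (smult a p) = a * coeff_pairing c p"
  by (subst coeff_pairing_eq[where N = "degree p"])
     (auto simp: coeff_pairing_def sum_distrib_left mult.assoc)

text \<open>For the sequence of derivatives of sech this shift is differentiation, up to the factor
  2 coming from D/2.\<close>

lemma coeff_pairing_pCons_0: "coeff_pairing c (pCons 0 p) = coeff_pairing (\<lambda>k. c (Suc k)) p"
  by (subst coeff_pairing_eq[where N = "Suc (degree p)"])
     (auto simp: coeff_pairing_def degree_pCons_le sum.atMost_Suc_shift simp del: sum.atMost_Suc)

lemma has_field_derivative_tanh_power_over_cosh:
  "((\<lambda>x::real. tanh x ^ m / cosh x) has_field_derivative
     (real m * (tanh x ^ (m - 1) / cosh x) - real (Suc m) * (tanh x ^ Suc m / cosh x))) (at x within A)"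
proof -
  have c: "cosh x \<noteq> 0" using cosh_real_pos[of x] by linarith
  have "((\<lambda>x::real. tanh x ^ m / cosh x) has_field_derivative
      (real m * tanh x ^ (m - 1) * (1 - tanh x ^ 2) - tanh x ^ m * tanh x) / cosh x) (at x within A)"
  proof -
    have "((\<lambda>x::real. tanh x ^ m / cosh x) has_field_derivative
       (real m * ((1 - tanh x ^ 2) * 1 * tanh x ^ (m - 1)) * cosh x - tanh x ^ m * sinh x) / (cosh x * cosh x)) (at x within A)"
      using c by (intro DERIV_divide DERIV_power has_field_derivative_tanh) (auto intro!: derivative_eq_intros)
    also have "sinh x = tanh x * cosh x" using c by (simp add: tanh_def)
    also have "(real m * ((1 - tanh x ^ 2) * 1 * tanh x ^ (m - 1)) * cosh x - tanh x ^ m * (tanh x * cosh x)) / (cosh x * cosh x)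
       = (real m * tanh x ^ (m - 1) * (1 - tanh x ^ 2) - tanh x ^ m * tanh x) / cosh x"
      using c by (simp add: divide_simps) (simp add: algebra_simps)
    finally show ?thesis .
  qed
  also have "(real m * tanh x ^ (m - 1) * (1 - tanh x ^ 2) - tanh x ^ m * tanh x) / cosh x =
      real m * (tanh x ^ (m - 1) / cosh x) - real (Suc m) * (tanh x ^ Suc m / cosh x)"
    by (cases m) (simp_all add: power2_eq_square algebra_simps add_divide_distrib diff_divide_distrib)
  finally show ?thesis .
qed

text \<open>That is, \<open>q_m(D/2) sech = (-1)^m tanh^m sech\<close>.\<close>

lemma coeff_pairing_sech_deriv_q_poly:
  "coeff_pairing (\<lambda>r. sech_deriv r x / 2 ^ r) (q_poly m) = (-1) ^ m * (tanh x ^ m / cosh x)"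
proof (induction m arbitrary: x rule: less_induct)
  case (less m)
  let ?L = "\<lambda>x. coeff_pairing (\<lambda>r. sech_deriv r x / 2 ^ r)"
  show ?case
  proof (cases m)
    case 0
    thus ?thesis by (simp add: q_poly_0 coeff_pairing_def sech_deriv_0)
  next
    case (Suc l)
    \<comment> \<open>The derivative of the same function is computed twice: termwise here, and from
      the induction hypothesis next. The hypothesis is differentiated, which is why x is arbitrary
      in the induction.\<close>
    have "((\<lambda>x. ?L x (q_poly l)) has_field_derivative 2 * ?L x (pCons 0 (q_poly l))) (at x)"
      unfolding coeff_pairing_pCons_0 unfolding coeff_pairing_def
      by (auto intro!: derivative_eq_intros has_field_derivative_sech_deriv sum.cong simp: sum_distrib_left)
    moreover have "((\<lambda>x. ?L x (q_poly l)) has_field_derivative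
        (-1) ^ l * (real l * (tanh x ^ (l - 1) / cosh x) - real (Suc l) * (tanh x ^ Suc l / cosh x))) (at x)"
      unfolding less.IH[of l, unfolded Suc, OF lessI]
      by (intro DERIV_cmult has_field_derivative_tanh_power_over_cosh)
    ultimately have "2 * ?L x (pCons 0 (q_poly l)) =
        (-1) ^ l * (real l * (tanh x ^ (l - 1) / cosh x) - real (Suc l) * (tanh x ^ Suc l / cosh x))"
      by (rule DERIV_unique)
    moreover have "real l * ?L x (q_poly (l - 1)) = real l * ((-1) ^ (l - 1) * (tanh x ^ (l - 1) / cosh x))"
      using less.IH[of "l - 1"] Suc by simp
    moreover have "real (Suc l) * ?L x (q_poly (Suc l)) =
        2 * ?L x (pCons 0 (q_poly l)) + real l * ?L x (q_poly (l - 1))"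
      using arg_cong[OF q_poly_Suc[of l], of "?L x"]
      by (simp only: coeff_pairing_add coeff_pairing_smult)
    \<comment> \<open>At l = 0 the truncated exponent would give the wrong sign, but both sides are
      then 0.\<close>
    moreover have "real l * ((-1) ^ (l - 1) * y) = - ((-1) ^ l * (real l * y))" for y :: real
      by (cases l) auto
    ultimately have "real (Suc l) * ?L x (q_poly (Suc l)) =
        real (Suc l) * ((-1) ^ Suc l * (tanh x ^ Suc l / cosh x))"
      by (simp add: right_diff_distrib mult.left_commute)
    thus ?thesis unfolding Suc by (simp only: mult_cancel_left) auto
  qed
qed

subsection \<open>Integrals of powers of \<open>1 / (a + ix)\<close>\<close>

text \<open>The integrands of the applications are not of one sign in general, so integrability is a
  premise here and has to be supplied by domination.\<close>

lemma LBINT_FTC_0_infty: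
  fixes f F :: "real \<Rightarrow> real"
  assumes "\<And>x. x > 0 \<Longrightarrow> (F has_field_derivative f x) (at x)"
    and "\<And>x. x > 0 \<Longrightarrow> isCont f x"
    and "set_integrable lborel {0<..} f"
    and "(F \<longlongrightarrow> A) (at_right 0)" "(F \<longlongrightarrow> B) at_top"
  shows "(LBINT x:{0<..}. f x) = B - A"
proof -
  have "einterval 0 \<infinity> = {0<..}" by (auto simp: einterval_def)
  moreover have "(LBINT x=0..\<infinity>. f x) = B - A"
    by (rule interval_integral_FTC_integrable[where F = F])
       (use assms calculation in \<open>auto simp: ereal_tendsto_simps zero_ereal_def has_real_derivative_iff_has_vector_derivative\<close>)
  ultimately show ?thesis by (simp add: interval_lebesgue_integral_0_infty)
qed

lemma set_integrable_Ioi_continuous_bound: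
  fixes f g :: "real \<Rightarrow> real"
  assumes "set_integrable lborel {0<..} f" "continuous_on {0<..} g"
    and "\<And>x. x > 0 \<Longrightarrow> \<bar>g x\<bar> \<le> f x"
  shows "set_integrable lborel {0<..} g"
proof (rule set_integrable_bound[OF assms(1)])
  show "set_borel_measurable lborel {0<..} g"
    using borel_measurable_continuous_on_indicator[OF _ assms(2)]
    by (simp add: set_borel_measurable_def)
  show "AE x in lborel. x \<in> {0<..} \<longrightarrow> norm (g x) \<le> norm (f x)"
    using assms(3) by fastforce
qed

text \<open>The antiderivative is arctan (x/a) / a. Because the integrand is nonnegative, the
  fundamental theorem gives integrability along with the value; this function then dominates all
  kernels below.\<close>

lemma
  fixes a :: real
  assumes "a > 0"
  shows set_integrable_inverse_sum_squares: "set_integrable lborel {0<..} (\<lambda>x. 1 / (a ^ 2 + x ^ 2))"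
    and LBINT_inverse_sum_squares: "(LBINT x:{0<..}. 1 / (a ^ 2 + x ^ 2)) = pi / (2 * a)"
proof -
  have e: "einterval 0 \<infinity> = {0::real<..}" by (auto simp: einterval_def)
  have pos: "a ^ 2 + x ^ 2 > 0" for x using assms by (simp add: add_pos_nonneg)
  have D: "((\<lambda>x. arctan (x / a) / a) has_field_derivative 1 / (a ^ 2 + x ^ 2)) (at x)" for x
  proof -
    have "((\<lambda>x. arctan (x / a) / a) has_field_derivative inverse (1 + (x / a) ^ 2) * (1 / a) / a) (at x)"
      by (intro DERIV_cdivide DERIV_chain2[OF DERIV_arctan] DERIV_ident)
    also have "inverse (1 + (x / a) ^ 2) * (1 / a) / a = 1 / (a ^ 2 * (1 + (x / a) ^ 2))"
      by (simp add: power2_eq_square field_simps)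
    also have "a ^ 2 * (1 + (x / a) ^ 2) = a ^ 2 + x ^ 2"
      using assms by (simp add: power_divide distrib_left)
    finally show ?thesis .
  qed
  have C: "isCont (\<lambda>x. 1 / (a ^ 2 + x ^ 2)) x" for x
    using pos[of x] by (intro continuous_intros) auto
  have 0: "((\<lambda>x. arctan (x / a) / a) \<longlongrightarrow> 0) (at_right 0)"
    using assms by (auto intro!: tendsto_eq_intros)
  have inf: "((\<lambda>x. arctan (x / a) / a) \<longlongrightarrow> (pi / 2) / a) at_top"
  proof -
    have "filterlim (\<lambda>x. inverse a * x) at_top at_top"
      using assms by (intro filterlim_tendsto_pos_mult_at_top[OF tendsto_const _ filterlim_ident]) auto
    hence "filterlim (\<lambda>x. x / a) at_top at_top" by (simp add: divide_inverse mult.commute)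
    thus ?thesis using assms
      by (intro tendsto_intros filterlim_compose[OF tendsto_arctan_at_top] tendsto_divide) auto
  qed
  have "set_integrable lborel (einterval 0 \<infinity>) (\<lambda>x. 1 / (a ^ 2 + x ^ 2))"
       "(LBINT x=0..\<infinity>. 1 / (a ^ 2 + x ^ 2)) = (pi / 2) / a - 0"
    by (rule interval_integral_FTC_nonneg[where F = "\<lambda>x. arctan (x / a) / a"];
        use D C 0 inf less_imp_le[OF pos] in \<open>auto simp: ereal_tendsto_simps zero_ereal_def\<close>)+
  thus "set_integrable lborel {0<..} (\<lambda>x. 1 / (a ^ 2 + x ^ 2))"
       "(LBINT x:{0<..}. 1 / (a ^ 2 + x ^ 2)) = pi / (2 * a)"
    by (simp_all add: e interval_lebesgue_integral_0_infty)
qed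

text \<open>The explicit factor |Im z| is the point: with z = 1 / (a + i x) it cancels the 1/x of
  the kernel, which the plain bound by a power of the norm cannot do.\<close>

lemma abs_Im_power_le: "\<bar>Im (z ^ Suc s)\<bar> \<le> real (Suc s) * norm z ^ s * \<bar>Im z\<bar>"
proof (induction s)
  case (Suc s)
  have "\<bar>Im (z ^ Suc (Suc s))\<bar> \<le> \<bar>Re z * Im (z ^ Suc s)\<bar> + \<bar>Im z * Re (z ^ Suc s)\<bar>"
    by (subst power_Suc) (simp only: times_complex.sel abs_triangle_ineq)
  also have "\<dots> \<le> norm z * (real (Suc s) * norm z ^ s * \<bar>Im z\<bar>) + \<bar>Im z\<bar> * norm z ^ Suc s"
  proof (intro add_mono)
    show "\<bar>Re z * Im (z ^ Suc s)\<bar> \<le> norm z * (real (Suc s) * norm z ^ s * \<bar>Im z\<bar>)"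
      unfolding abs_mult by (rule mult_mono[OF abs_Re_le_cmod Suc.IH norm_ge_zero abs_ge_zero])
    have "\<bar>Re (z ^ Suc s)\<bar> \<le> norm z ^ Suc s"
      by (metis abs_Re_le_cmod norm_power)
    thus "\<bar>Im z * Re (z ^ Suc s)\<bar> \<le> \<bar>Im z\<bar> * norm z ^ Suc s"
      unfolding abs_mult by (rule mult_left_mono[OF _ abs_ge_zero])
  qed
  also have "\<dots> = real (Suc (Suc s)) * norm z ^ Suc s * \<bar>Im z\<bar>"
    by (simp add: algebra_simps)
  finally show ?case .
qed simp

text \<open>The exponent is \<open>Suc s\<close> so that s is the order of the derivative: the
  polygamma series of order s has terms with exponent s + 1.\<close>

definition resolvent_kernel :: "nat \<Rightarrow> real \<Rightarrow> real \<Rightarrow> real" where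
  "resolvent_kernel s a x = Im (inverse (Complex a x) ^ Suc s) / x"

lemma abs_resolvent_kernel_le:
  assumes "a > 0" "x > 0"
  shows "\<bar>resolvent_kernel s a x\<bar> \<le> real (Suc s) / a ^ s * (1 / (a ^ 2 + x ^ 2))"
proof -
  define w where "w = inverse (Complex a x)"
  have "norm w \<le> 1 / a"
    using assms abs_Re_le_cmod[of "Complex a x"]
    by (simp add: w_def norm_inverse inverse_eq_divide frac_le norm_divide)
  hence "norm w ^ s \<le> 1 / a ^ s"
    by (metis norm_ge_zero power_mono power_one_over)
  moreover have "\<bar>Im w\<bar> = x * (1 / (a ^ 2 + x ^ 2))"
    using assms by (simp add: w_def)
  ultimately have "real (Suc s) * norm w ^ s * \<bar>Im w\<bar> \<le> real (Suc s) * (1 / a ^ s) * (x * (1 / (a ^ 2 + x ^ 2)))"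
    using assms by (intro mult_mono) auto
  hence "\<bar>Im (w ^ Suc s)\<bar> \<le> real (Suc s) * (1 / a ^ s) * (x * (1 / (a ^ 2 + x ^ 2)))"
    using abs_Im_power_le[of w s] by linarith
  thus ?thesis using assms
    by (simp add: resolvent_kernel_def w_def abs_divide divide_le_eq mult_ac del: power_Suc)
qed

lemma continuous_on_resolvent:
  assumes "a > 0"
  shows "continuous_on A (\<lambda>x. inverse (Complex a x) ^ s)"
proof -
  have "continuous_on A (\<lambda>x. inverse (of_real a + \<i> * of_real x) ^ s)"
    using assms by (intro continuous_intros) (auto simp: complex_eq_iff)
  thus ?thesis by (simp add: Complex_eq)
qed

lemma set_integrable_resolvent_kernel:
  assumes "a > 0"
  shows "set_integrable lborel {0<..} (resolvent_kernel s a)"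
proof (rule set_integrable_Ioi_continuous_bound)
  show "set_integrable lborel {0<..} (\<lambda>x. real (Suc s) / a ^ s * (1 / (a ^ 2 + x ^ 2)))"
    by (intro set_integrable_mult_right set_integrable_inverse_sum_squares assms)
  show "continuous_on {0<..} (resolvent_kernel s a)"
    unfolding resolvent_kernel_def by (intro continuous_intros continuous_on_resolvent assms) auto
qed (use abs_resolvent_kernel_le assms in auto)

text \<open>The derivative of (a + i x)^(-(s+1)) is -(s+1) i (a + i x)^(-(s+2)), and the factor i
  turns its imaginary part into a real part of the next power. The primitive vanishes at 0, where
  the base is real, and at infinity. Exponent at least 2 ensures absolute integrability.\<close>

lemma
  assumes "a > 0"
  shows set_integrable_Re_resolvent: "set_integrable lborel {0<..} (\<lambda>x. Re (inverse (Complex a x) ^ Suc (Suc s)))"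
    and LBINT_Re_resolvent: "(LBINT x:{0<..}. Re (inverse (Complex a x) ^ Suc (Suc s))) = 0"
proof -
  have bound: "norm (inverse (Complex a x) ^ Suc (Suc s)) \<le> (1 / a ^ s) * (1 / (a ^ 2 + x ^ 2))" for x
  proof -
    have "norm (inverse (Complex a x)) ^ s \<le> (1 / a) ^ s"
      using assms abs_Re_le_cmod[of "Complex a x"]
      by (intro power_mono) (auto simp: norm_divide inverse_eq_divide frac_le)
    moreover have "norm (inverse (Complex a x)) ^ 2 = 1 / (a ^ 2 + x ^ 2)"
      by (simp add: norm_divide power_divide cmod_power2 inverse_eq_divide)
    ultimately have "norm (inverse (Complex a x)) ^ s * norm (inverse (Complex a x)) ^ 2
        \<le> (1 / a) ^ s * (1 / (a ^ 2 + x ^ 2))"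
      using assms by (intro mult_mono) auto
    thus ?thesis by (simp add: norm_mult norm_power power2_eq_square power_one_over mult_ac)
  qed
  have bound': "\<bar>Re (inverse (Complex a x) ^ Suc (Suc s))\<bar> \<le> (1 / a ^ s) * (1 / (a ^ 2 + x ^ 2))" for x
    using bound[of x] abs_Re_le_cmod order_trans by blast
  show int: "set_integrable lborel {0<..} (\<lambda>x. Re (inverse (Complex a x) ^ Suc (Suc s)))"
  proof (rule set_integrable_Ioi_continuous_bound)
    show "set_integrable lborel {0<..} (\<lambda>x. 1 / a ^ s * (1 / (a ^ 2 + x ^ 2)))"
      by (intro set_integrable_mult_right set_integrable_inverse_sum_squares assms)
    show "continuous_on {0<..} (\<lambda>x. Re (inverse (Complex a x) ^ Suc (Suc s)))"
      by (intro continuous_intros continuous_on_resolvent assms)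
  qed (rule bound')
  have D: "((\<lambda>x. - Im (inverse (Complex a x) ^ Suc s) / real (Suc s)) has_field_derivative
       Re (inverse (Complex a x) ^ Suc (Suc s))) (at x)" for x
  proof -
    \<comment> \<open>The complex derivative is taken first and then restricted to the real
      line.\<close>
    have nz: "of_real a + \<i> * of_real x \<noteq> 0" using assms by (simp add: complex_eq_iff)
    have "((\<lambda>w. inverse (of_real a + \<i> * w) ^ Suc s) has_field_derivative
        of_nat (Suc s) * (- \<i> * inverse (of_real a + \<i> * of_real x) ^ Suc (Suc s))) (at (of_real x))"
    proof -
      have "((\<lambda>w. inverse (of_real a + \<i> * w)) has_field_derivative
          - (\<i> * inverse (of_real a + \<i> * of_real x) ^ 2)) (at (of_real x))"
        using nz by (auto intro!: derivative_eq_intros simp: power2_eq_square)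
      from DERIV_power[OF this, of "Suc s"] show ?thesis
        by (rule DERIV_cong) (simp add: power2_eq_square mult_ac)
    qed
    from has_vector_derivative_real_field[OF this]
    have "((\<lambda>x. inverse (of_real a + \<i> * of_real x) ^ Suc s) has_vector_derivative
        of_nat (Suc s) * (- \<i> * inverse (of_real a + \<i> * of_real x) ^ Suc (Suc s))) (at x)" .
    moreover have "Im (of_nat n * (- \<i> * W)) = real n * - Re W" for n W
      by simp
    ultimately
    have "((\<lambda>x. Im (inverse (Complex a x) ^ Suc s)) has_field_derivative
        real (Suc s) * - Re (inverse (Complex a x) ^ Suc (Suc s))) (at x)"
      unfolding has_real_derivative_iff_has_vector_derivative Complex_eq
      by (metis bounded_linear.has_vector_derivative[OF bounded_linear_Im])
    from DERIV_cdivide[OF DERIV_minus[OF this], of "real (Suc s)"] show ?thesis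
      by (simp del: power_Suc of_nat_Suc)
  qed
  have "(LBINT x:{0<..}. Re (inverse (Complex a x) ^ Suc (Suc s))) = 0 - 0"
  proof (rule LBINT_FTC_0_infty[OF D _ int])
    show "isCont (\<lambda>x. Re (inverse (Complex a x) ^ Suc (Suc s))) x" for x
      using continuous_on_resolvent[OF assms, of UNIV "Suc (Suc s)"]
      by (simp add: continuous_on_eq_continuous_at isCont_Re del: power_Suc)
    have "isCont (\<lambda>x. Im (inverse (Complex a x) ^ Suc s)) 0"
      using continuous_on_resolvent[OF assms, of UNIV "Suc s"]
      by (simp add: continuous_on_eq_continuous_at isCont_Im del: power_Suc)
    hence "((\<lambda>x. Im (inverse (Complex a x) ^ Suc s)) \<longlongrightarrow> Im (inverse (Complex a 0) ^ Suc s)) (at_right 0)"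
      unfolding isCont_def by (rule filterlim_mono[OF _ order_refl at_le]) simp
    moreover have "inverse (Complex a 0) ^ Suc s = of_real (inverse a ^ Suc s)"
      by (simp add: complex_of_real_def[symmetric] del: power_Suc)
    ultimately have "((\<lambda>x. Im (inverse (Complex a x) ^ Suc s)) \<longlongrightarrow> 0) (at_right 0)"
      by (simp only: Im_complex_of_real)
    from tendsto_divide[OF tendsto_minus[OF this] tendsto_const, of "real (Suc s)"]
    show "((\<lambda>x. - Im (inverse (Complex a x) ^ Suc s) / real (Suc s)) \<longlongrightarrow> 0) (at_right 0)" by simp
    have "((\<lambda>x. inverse (Complex a x) ^ Suc s) \<longlongrightarrow> 0 ^ Suc s) at_top"
    proof (intro tendsto_power, rule filterlim_compose[OF tendsto_inverse_0])
      show "filterlim (Complex a) at_infinity at_top"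
      proof (rule filterlim_norm_at_top_imp_at_infinity, rule filterlim_at_top_mono[OF filterlim_ident])
        show "eventually (\<lambda>x. x \<le> norm (Complex a x)) at_top"
          by (intro always_eventually allI) (metis abs_Im_le_cmod abs_le_D1 complex.sel(2))
      qed
    qed
    from tendsto_divide[OF tendsto_minus[OF tendsto_Im[OF this]] tendsto_const, of "real (Suc s)"]
    show "((\<lambda>x. - Im (inverse (Complex a x) ^ Suc s) / real (Suc s)) \<longlongrightarrow> 0) at_top" by simp
  qed
  thus "(LBINT x:{0<..}. Re (inverse (Complex a x) ^ Suc (Suc s))) = 0" by simp
qed

text \<open>With w = 1 / (a + i x), the imaginary part of w^(s+1) = (a + i x) w^(s+2), divided by x,
  is a times the next kernel plus Re (w^(s+2)). The last term integrates to 0, so each further power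
  costs a factor 1/a.\<close>

lemma LBINT_resolvent_kernel:
  assumes "a > 0"
  shows "(LBINT x:{0<..}. resolvent_kernel s a x) = - (pi / 2) / a ^ Suc s"
proof (induction s)
  case 0
  have "(LBINT x:{0<..}. resolvent_kernel 0 a x) = (LBINT x:{0<..}. - (1 / (a ^ 2 + x ^ 2)))"
    by (rule set_lebesgue_integral_cong) (auto simp: resolvent_kernel_def)
  also have "\<dots> = - (pi / (2 * a))"
    using LBINT_inverse_sum_squares[OF assms] by (simp add: set_lebesgue_integral_def)
  finally show ?case by simp
next
  case (Suc s)
  have split: "resolvent_kernel s a x = a * resolvent_kernel (Suc s) a x + Re (inverse (Complex a x) ^ Suc (Suc s))"
    if "x > 0" for x
  proof -
    define w where "w = inverse (Complex a x)"
    have "Complex a x \<noteq> 0" using assms by (simp add: complex_eq_iff)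
    hence "w ^ Suc s = Complex a x * w ^ Suc (Suc s)" by (simp add: w_def)
    hence "Im (w ^ Suc s) = a * Im (w ^ Suc (Suc s)) + x * Re (w ^ Suc (Suc s))"
      by (metis complex.sel(1,2) times_complex.sel(2))
    thus ?thesis using that by (simp add: resolvent_kernel_def w_def add_divide_distrib del: power_Suc)
  qed
  have "(LBINT x:{0<..}. resolvent_kernel s a x) =
      (LBINT x:{0<..}. a * resolvent_kernel (Suc s) a x + Re (inverse (Complex a x) ^ Suc (Suc s)))"
    using split by (intro set_lebesgue_integral_cong) auto
  also have "\<dots> = a * (LBINT x:{0<..}. resolvent_kernel (Suc s) a x)"
    using assms set_integrable_resolvent_kernel[OF assms] set_integrable_Re_resolvent[OF assms] LBINT_Re_resolvent[OF assms]
    by (subst set_integral_add) (auto simp del: power_Suc)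
  finally show ?case using assms Suc by (simp add: field_simps)
qed

text \<open>One bound gives pointwise convergence of the series and the other summability of the L1
  norms. For r >= 1 both decay like 1 / (k+1)^2, so the series at 3/4 and at 1/4 can be treated
  separately, without cancellation.\<close>

lemma resolvent_kernel_bounds:
  assumes "a \<ge> real (Suc k)"  "r \<ge> 1" "x > 0"
  shows "\<bar>resolvent_kernel r a x\<bar> \<le> real (Suc r) * inverse (real (Suc k) ^ 2)"
    and "(LBINT x:{0<..}. \<bar>resolvent_kernel r a x\<bar>) \<le> real (Suc r) * pi / 2 * inverse (real (Suc k) ^ 2)"
proof -
  have a: "a > 0" "a \<ge> 1" using assms(1) by auto
  have "\<bar>resolvent_kernel r a x\<bar> \<le> real (Suc r) / a ^ r * (1 / (a ^ 2 + x ^ 2))"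
    using abs_resolvent_kernel_le a assms by blast
  also have "\<dots> \<le> real (Suc r) * (1 / real (Suc k) ^ 2)"
  proof (intro mult_mono)
    show "real (Suc r) / a ^ r \<le> real (Suc r)"
      using a one_le_power[of a r] by (simp add: divide_le_eq)
    have "real (Suc k) ^ 2 \<le> a ^ 2" using assms by (intro power_mono) auto
    also have "\<dots> \<le> a ^ 2 + x ^ 2" by simp
    finally show "1 / (a ^ 2 + x ^ 2) \<le> 1 / real (Suc k) ^ 2"
      using a by (intro divide_left_mono) (auto intro!: mult_pos_pos add_pos_nonneg)
  qed (use a in auto)
  finally show "\<bar>resolvent_kernel r a x\<bar> \<le> real (Suc r) * inverse (real (Suc k) ^ 2)"
    by (simp add: inverse_eq_divide)
  have "(LBINT x:{0<..}. \<bar>resolvent_kernel r a x\<bar>) \<le>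
        (LBINT x:{0<..}. real (Suc r) / a ^ r * (1 / (a ^ 2 + x ^ 2)))"
    by (intro set_integral_mono set_integrable_abs set_integrable_resolvent_kernel
        set_integrable_mult_right set_integrable_inverse_sum_squares a)
       (use abs_resolvent_kernel_le[OF a(1)] in auto)
  also have "\<dots> = real (Suc r) / a ^ r * (pi / (2 * a))"
    by (simp only: set_integral_mult_right LBINT_inverse_sum_squares[OF a(1)])
  also have "\<dots> = real (Suc r) * pi / 2 * (1 / a ^ Suc r)"
    by simp
  also have "\<dots> \<le> real (Suc r) * pi / 2 * (1 / real (Suc k) ^ 2)"
  proof (intro mult_left_mono divide_left_mono)
    have "real (Suc k) ^ 2 \<le> a ^ 2" using assms by (intro power_mono) auto
    also have "\<dots> \<le> a ^ Suc r" using assms a by (intro power_increasing) auto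
    finally show "real (Suc k) ^ 2 \<le> a ^ Suc r" .
  qed (use a in auto)
  finally show "(LBINT x:{0<..}. \<bar>resolvent_kernel r a x\<bar>) \<le> real (Suc r) * pi / 2 * inverse (real (Suc k) ^ 2)"
    by (simp add: inverse_eq_divide)
qed

subsection \<open>Termwise integration of the polygamma series\<close>

text \<open>Neighbouring terms are paired to separate the residues 1 and 3 modulo 4, matching the
  shifts 1/4 and 3/4 of the polygamma series after scaling by 4.\<close>

lemma dirichlet_beta_sums:
  assumes "s \<ge> 2"
  shows "(\<lambda>k. 1 / (4 * real k + 1) ^ s - 1 / (4 * real k + 3) ^ s) sums dirichlet_beta (real s)"
proof -
  define f where "f k = (-1) ^ k * (2 * real k + 1) powr (- real s)" for k
  have f: "f k = (-1) ^ k * (1 / (2 * real k + 1) ^ s)" for k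
    by (simp add: f_def powr_minus powr_realpow inverse_eq_divide)
  have "summable f"
  proof (rule summable_comparison_test')
    show "summable (\<lambda>k. inverse (real (Suc k) ^ 2))"
      by (subst summable_Suc_iff) (rule inverse_power_summable, simp)
    fix k :: nat
    have "real (Suc k) ^ 2 \<le> (2 * real k + 1) ^ 2" by (intro power_mono) auto
    also have "\<dots> \<le> (2 * real k + 1) ^ s" using assms by (intro power_increasing) auto
    finally have "1 / (2 * real k + 1) ^ s \<le> 1 / real (Suc k) ^ 2"
      by (intro divide_left_mono) auto
    thus "norm (f k) \<le> inverse (real (Suc k) ^ 2)"
      by (simp add: f abs_mult inverse_eq_divide)
  qed
  hence "f sums dirichlet_beta (real s)"
    by (simp add: summable_sums dirichlet_beta_def f_def[abs_def])
  from sums_group[OF this, of 2]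
  have "(\<lambda>k. sum f {k * 2..<k * 2 + 2}) sums dirichlet_beta (real s)" by simp
  moreover have "sum f {k * 2..<k * 2 + 2} = 1 / (4 * real k + 1) ^ s - 1 / (4 * real k + 3) ^ s" for k
    by (simp add: numeral_2_eq_2 f) (simp add: algebra_simps)
  ultimately show ?thesis by simp
qed

text \<open>For r = 2 j + 1 the sign (-1)^(r+1) of the polygamma series is 1 and i^r = (-1)^j i.
  Hence the real part selects the negative imaginary part of each power, and the total sign is
  (-1)^(j+1).\<close>

lemma sech_deriv_sums:
  assumes "odd r"
  shows "(\<lambda>k. (-1) ^ (Suc r div 2) * 2 * fact r *
      (resolvent_kernel r (2 * pi * (3/4 + real k)) x - resolvent_kernel r (2 * pi * (1/4 + real k)) x))
      sums (sech_deriv r x / x)"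
proof -
  define c where "c = \<i> / (2 * of_real pi)"
  define P where "P a k = inverse ((Complex a (x / (2 * pi)) + of_nat k) ^ Suc r)" for a k
  have P: "P a sums (Polygamma r (Complex a (x / (2 * pi))) / fact r)" if "a > 0" for a
  proof -
    have "Complex a (x / (2 * pi)) \<noteq> 0" "r > 0"
      using that assms by (auto simp: complex_eq_iff elim!: oddE)
    from Polygamma_LIMSEQ[OF this] show ?thesis
      using assms by (simp add: P_def[abs_def])
  qed
  \<comment> \<open>Pulling 2 pi out of the denominator uses up c^r, leaving i^r and one factor 2
    pi. The factor x undoes the division in the kernel; at x = 0 the left side vanishes too, as c^r
    is imaginary and the term is real.\<close>
  have Re: "Re (c ^ r * P a k) = (-1) ^ (Suc r div 2) * (2 * pi) * (resolvent_kernel r (2 * pi * (a + real k)) x * x)" for a k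
  proof (cases "x = 0")
    case True
    have "P a k = of_real (inverse ((a + real k) ^ Suc r))"
      by (simp add: P_def True complex_of_real_def[symmetric] del: power_Suc)
    moreover obtain j where "r = 2 * j + 1" using assms by (elim oddE)
    ultimately show ?thesis
      by (simp add: True c_def power_divide power_mult_distrib power_mult)
  next
    case False
    have "Complex (2 * pi * (a + real k)) x = of_real (2 * pi) * (Complex a (x / (2 * pi)) + of_nat k)"
      by (simp add: complex_eq_iff algebra_simps)
    hence "inverse (Complex a (x / (2 * pi)) + of_nat k) = of_real (2 * pi) * inverse (Complex (2 * pi * (a + real k)) x)"
      by simp
    hence "P a k = of_real (2 * pi) ^ Suc r * inverse (Complex (2 * pi * (a + real k)) x) ^ Suc r"
      unfolding P_def power_inverse[symmetric] by (simp only: power_mult_distrib)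
    hence "c ^ r * P a k = (c * of_real (2 * pi)) ^ r * (of_real (2 * pi) * inverse (Complex (2 * pi * (a + real k)) x) ^ Suc r)"
      by (simp only: power_mult_distrib power_Suc mult_ac)
    moreover have "c * of_real (2 * pi) = \<i>" by (simp add: c_def)
    moreover obtain j where j: "r = 2 * j + 1" using assms by (elim oddE)
    moreover from j have "\<i> ^ r = of_real ((-1) ^ j) * \<i>" by (simp add: power_mult)
    moreover have "Re (of_real ((-1) ^ j) * \<i> * (of_real (2 * pi) * W)) = (-1) ^ Suc j * (2 * pi) * Im W" for W
      by (simp add: mult.assoc del: of_real_power of_real_mult)
    ultimately have "Re (c ^ r * P a k) = (-1) ^ Suc j * (2 * pi) * Im (inverse (Complex (2 * pi * (a + real k)) x) ^ Suc r)"
      by (simp only:)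
    thus ?thesis using j False by (simp add: resolvent_kernel_def del: power_Suc)
  qed
  have "(\<lambda>k. Re (c ^ r * (P (3/4) k - P (1/4) k))) sums
     Re (c ^ r * (Polygamma r (Complex (3/4) (x / (2 * pi))) / fact r - Polygamma r (Complex (1/4) (x / (2 * pi))) / fact r))"
    by (intro sums_Re sums_mult sums_diff P) auto
  from sums_divide[OF sums_mult[OF this, of "fact r / pi"], of x]
  have "(\<lambda>k. fact r / pi * Re (c ^ r * (P (3/4) k - P (1/4) k)) / x) sums
     (fact r / pi * Re (c ^ r * (Polygamma r (Complex (3/4) (x / (2 * pi))) / fact r - Polygamma r (Complex (1/4) (x / (2 * pi))) / fact r)) / x)" .
  moreover have "fact r / pi * Re (c ^ r * (P (3/4) k - P (1/4) k)) / x = (-1) ^ (Suc r div 2) * 2 * fact r *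
      (resolvent_kernel r (2 * pi * (3/4 + real k)) x - resolvent_kernel r (2 * pi * (1/4 + real k)) x)" for k
  proof -
    have diff: "Re (c ^ r * (P (3/4) k - P (1/4) k)) = Re (c ^ r * P (3/4) k) - Re (c ^ r * P (1/4) k)"
      by (simp only: right_diff_distrib minus_complex.sel)
    have scale: "fact r / pi * (e * (2 * pi) * (A * x) - e * (2 * pi) * (B * x)) / x = e * 2 * fact r * (A - B)"
      if "x \<noteq> 0" for A B e :: real
      using that by (simp add: field_simps)
    show ?thesis
    proof (cases "x = 0")
      case True
      thus ?thesis by (simp add: resolvent_kernel_def)
    next
      case False
      show ?thesis unfolding diff Re by (rule scale[OF False])
    qed
  qed
  moreover have "fact r * Re (c ^ r * (A / fact r - B / fact r)) = Re (c ^ r * (A - B))" for A B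
  proof -
    have "c ^ r * (A / fact r - B / fact r) = (c ^ r * (A - B)) / of_real (fact r)"
      by (simp add: diff_divide_distrib right_diff_distrib)
    thus ?thesis by (simp only: Re_divide_of_real) simp
  qed
  ultimately show ?thesis
    unfolding sech_deriv_def c_def[symmetric] by (simp only: times_divide_eq_left)
qed

text \<open>Termwise integration gives the constant (-1)^((r+1)/2) 2 r! (pi/2) (2/pi)^(r+1) in front
  of beta(r+1), which is 2^(r+1) times the factor in \<open>b_val\<close>.\<close>

lemma
  assumes "odd r"
  shows set_integrable_sech_deriv: "set_integrable lborel {0<..} (\<lambda>x. sech_deriv r x / x)"
    and LBINT_sech_deriv: "(LBINT x:{0<..}. sech_deriv r x / x) = 2 ^ Suc r * b_val (Suc r)"
proof -
  define c :: real where "c = (-1) ^ (Suc r div 2) * 2 * fact r"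
  define K where "K a k = resolvent_kernel r (2 * pi * (a + real k))" for a k
  define f where "f k x = indicator {0<..} x *\<^sub>R (c * (K (3/4) k x - K (1/4) k x))" for k and x :: real
  have r: "r \<ge> 1" using assms by (cases r) auto
  \<comment> \<open>A crude bound common to both shifts: 2 pi >= 4 and 4 (1/4 + k) >= k + 1.\<close>
  have arg: "2 * pi * (a + real k) \<ge> real (Suc k)" if "a \<ge> 1/4" for a k
  proof -
    have "real (Suc k) \<le> 4 * (1/4 + real k)" by simp
    also have "\<dots> \<le> 2 * pi * (a + real k)"
      using that pi_ge_two by (intro mult_mono) auto
    finally show ?thesis .
  qed
  have argpos: "2 * pi * (a + real k) > 0" if "a \<ge> 1/4" for a k
    using arg[OF that, of k] by linarith
  note K_int = set_integrable_resolvent_kernel[OF argpos, of _ r, folded K_def]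
  have fsum: "(\<lambda>k. f k x) sums (indicator {0<..} x *\<^sub>R (sech_deriv r x / x))" for x
    using sech_deriv_sums[OF assms, of x] unfolding f_def K_def c_def
    by (cases "x > 0") auto
  have sum2: "summable (\<lambda>k. C * inverse (real (Suc k) ^ 2))" for C
    by (intro summable_mult, subst summable_Suc_iff) (rule inverse_power_summable, simp)
  \<comment> \<open>The facts \<open>1\<close>, \<open>2\<close> and \<open>3\<close> are the
    premises for exchanging sum and integral: integrable terms, pointwise absolute convergence,
    summable L1 norms.\<close>
  have 1: "integrable lborel (f k)" for k
    using K_int[of "3/4" k] K_int[of "1/4" k] unfolding f_def
    by (subst set_integrable_def[symmetric]) auto
  have 2: "summable (\<lambda>k. norm (f k x))" for x
  proof (rule summable_comparison_test'[OF sum2[of "\<bar>c\<bar> * (2 * real (Suc r))"]])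
    fix k :: nat
    show "norm (norm (f k x)) \<le> \<bar>c\<bar> * (2 * real (Suc r)) * inverse (real (Suc k) ^ 2)"
    proof (cases "x > 0")
      case True
      have "\<bar>K (3/4) k x - K (1/4) k x\<bar> \<le> 2 * real (Suc r) * inverse (real (Suc k) ^ 2)"
        using resolvent_kernel_bounds(1)[OF arg[of "3/4" k] r True]
          resolvent_kernel_bounds(1)[OF arg[of "1/4" k] r True]
        unfolding K_def by linarith
      from mult_left_mono[OF this, of "\<bar>c\<bar>"] True show ?thesis
        by (simp add: f_def abs_mult mult.assoc)
    qed (simp add: f_def)
  qed
  have 3: "summable (\<lambda>k. LBINT x. norm (f k x))"
  proof (rule summable_comparison_test'[OF sum2[of "\<bar>c\<bar> * (real (Suc r) * pi)"]])
    fix k :: nat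
    have "(LBINT x. norm (f k x)) = (LBINT x:{0<..}. \<bar>c\<bar> * \<bar>K (3/4) k x - K (1/4) k x\<bar>)"
      unfolding set_lebesgue_integral_def
      by (intro Bochner_Integration.integral_cong) (auto simp: f_def abs_mult)
    also have "\<dots> \<le> (LBINT x:{0<..}. \<bar>c\<bar> * (\<bar>K (3/4) k x\<bar> + \<bar>K (1/4) k x\<bar>))"
      by (intro set_integral_mono set_integrable_mult_right set_integrable_abs set_integral_add set_integral_diff K_int
          mult_left_mono abs_triangle_ineq4) auto
    also have "\<dots> = \<bar>c\<bar> * ((LBINT x:{0<..}. \<bar>K (3/4) k x\<bar>) + (LBINT x:{0<..}. \<bar>K (1/4) k x\<bar>))"
      by (subst set_integral_mult_right, subst set_integral_add)
         (auto intro!: set_integrable_abs K_int)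
    also have "\<dots> \<le> \<bar>c\<bar> * (real (Suc r) * pi / 2 * inverse (real (Suc k) ^ 2) + real (Suc r) * pi / 2 * inverse (real (Suc k) ^ 2))"
      unfolding K_def
      by (intro mult_left_mono add_mono resolvent_kernel_bounds(2)[OF arg r zero_less_one]) auto
    also have "\<dots> = \<bar>c\<bar> * (real (Suc r) * pi) * inverse (real (Suc k) ^ 2)"
      by (simp add: field_simps)
    finally show "norm (LBINT x. norm (f k x)) \<le> \<bar>c\<bar> * (real (Suc r) * pi) * inverse (real (Suc k) ^ 2)"
      by (simp add: integral_nonneg_AE)
  qed
  have sum_eq: "(\<Sum>k. f k x) = indicator {0<..} x *\<^sub>R (sech_deriv r x / x)" for x
    using fsum by (rule sums_unique[symmetric])
  show "set_integrable lborel {0<..} (\<lambda>x. sech_deriv r x / x)"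
    using integrable_suminf[OF 1 AE_I2[OF 2] 3] unfolding sum_eq set_integrable_def .
  have "(\<lambda>k. LBINT x. f k x) sums (LBINT x:{0<..}. sech_deriv r x / x)"
    using sums_integral[OF 1 AE_I2[OF 2] 3] unfolding sum_eq set_lebesgue_integral_def .
  moreover have "(LBINT x. f k x) = c * (pi / 2) * (2 / pi) ^ Suc r *
      (1 / (4 * real k + 1) ^ Suc r - 1 / (4 * real k + 3) ^ Suc r)" for k
  proof -
    have K: "(LBINT x:{0<..}. K a k x) = - (pi / 2) * (2 / pi) ^ Suc r * (1 / (4 * (a + real k)) ^ Suc r)" if "a \<ge> 1/4" for a
    proof -
      have "(LBINT x:{0<..}. K a k x) = - (pi / 2) / (2 * pi * (a + real k)) ^ Suc r"
        unfolding K_def by (rule LBINT_resolvent_kernel[OF argpos[OF that]])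
      \<comment> \<open>This exposes the odd integers 4 k + 3 and 4 k + 1 as 4 (a + k).\<close>
      also have "2 * pi * (a + real k) = (4 * (a + real k)) / (2 / pi)" by (simp add: field_simps)
      finally show ?thesis by (simp only: power_divide) (simp del: power_Suc)
    qed
    have "(LBINT x. f k x) = (LBINT x:{0<..}. c * (K (3/4) k x - K (1/4) k x))"
      by (simp only: f_def set_lebesgue_integral_def)
    also have "\<dots> = c * ((LBINT x:{0<..}. K (3/4) k x) - (LBINT x:{0<..}. K (1/4) k x))"
      by (subst set_integral_mult_right, subst set_integral_diff) (auto intro!: K_int)
    also have "\<dots> = c * (- (pi / 2) * (2 / pi) ^ Suc r * (1 / (4 * real k + 3) ^ Suc r)
        - - (pi / 2) * (2 / pi) ^ Suc r * (1 / (4 * real k + 1) ^ Suc r))"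
      by (subst (1 2) K) (simp_all add: algebra_simps del: power_Suc)
    finally show ?thesis by (simp add: algebra_simps del: power_Suc)
  qed
  ultimately have "(\<lambda>k. c * (pi / 2) * (2 / pi) ^ Suc r *
      (1 / (4 * real k + 1) ^ Suc r - 1 / (4 * real k + 3) ^ Suc r)) sums (LBINT x:{0<..}. sech_deriv r x / x)"
    by simp
  moreover have "(\<lambda>k. c * (pi / 2) * (2 / pi) ^ Suc r *
      (1 / (4 * real k + 1) ^ Suc r - 1 / (4 * real k + 3) ^ Suc r)) sums
      (c * (pi / 2) * (2 / pi) ^ Suc r * dirichlet_beta (real (Suc r)))"
    using r by (intro sums_mult dirichlet_beta_sums) auto
  ultimately have "(LBINT x:{0<..}. sech_deriv r x / x) = c * (pi / 2) * (2 / pi) ^ Suc r * dirichlet_beta (real (Suc r))"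
    by (rule sums_unique2)
  thus "(LBINT x:{0<..}. sech_deriv r x / x) = 2 ^ Suc r * b_val (Suc r)"
    by (simp add: c_def b_val_def power_divide)
qed

subsection \<open>Integration by parts and conclusion\<close>

lemma tanh_real_le_self:
  assumes "x \<ge> 0"
  shows "tanh x \<le> (x::real)"
proof -
  have "\<exists>y. ((\<lambda>x. x - tanh x) has_real_derivative y) (at x) \<and> 0 \<le> y" for x :: real
  proof -
    have "cosh x \<noteq> 0" using cosh_real_pos[of x] by linarith
    hence "((\<lambda>x. x - tanh x) has_real_derivative tanh x ^ 2) (at x)"
      by (auto intro!: derivative_eq_intros)
    thus ?thesis by (intro exI[of _ "tanh x ^ 2"]) auto
  qed
  hence "0 - tanh 0 \<le> x - tanh x"
    by (intro DERIV_nonneg_imp_nondecreasing[OF assms, of "\<lambda>x. x - tanh x"]) blast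
  thus ?thesis by simp
qed

lemma set_integrable_sech: "set_integrable lborel {0<..} (\<lambda>x::real. 1 / cosh x)"
proof (rule set_integrable_Ioi_continuous_bound)
  show "set_integrable lborel {0<..} (\<lambda>x::real. 4 * (1 / (1 ^ 2 + x ^ 2)))"
    by (intro set_integrable_mult_right set_integrable_inverse_sum_squares) auto
  have nz: "cosh x \<noteq> 0" for x :: real using cosh_real_pos[of x] by linarith
  show "continuous_on {0<..} (\<lambda>x::real. 1 / cosh x)"
    using nz by (intro continuous_intros) auto
  fix x :: real assume "x > 0"
  \<comment> \<open>From exp x >= 1 + x + x^2/2 >= (1 + x^2) / 2; this is the origin of the factor 4
    in the dominating function.\<close>
  hence "(1 + x ^ 2) / 4 \<le> exp x / 2" using exp_lower_Taylor_quadratic[of x] by simp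
  also have "\<dots> \<le> cosh x" by (simp add: cosh_field_def)
  finally have "(1 + x ^ 2) / 4 \<le> cosh x" .
  hence "1 / cosh x \<le> 1 / ((1 + x ^ 2) / 4)"
    by (intro divide_left_mono mult_pos_pos) (auto simp: add_pos_nonneg)
  thus "\<bar>1 / cosh x\<bar> \<le> 4 * (1 / (1 ^ 2 + x ^ 2))" by simp
qed

text \<open>Rests on tanh x / x <= 1. The surplus power of tanh is kept because it makes the
  boundary term at 0 vanish when n < m.\<close>

lemma tanh_power_bound:
  fixes x :: real
  assumes "n \<le> m" "x > 0"
  shows "0 \<le> tanh x ^ m / (x ^ n * cosh x)"
    and "tanh x ^ m / (x ^ n * cosh x) \<le> tanh x ^ (m - n) * (1 / cosh x)"
proof -
  have t: "tanh x \<ge> 0" "tanh x \<le> x" using assms tanh_real_le_self by auto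
  show "0 \<le> tanh x ^ m / (x ^ n * cosh x)" using assms t by auto
  have "(tanh x / x) ^ n \<le> 1" using t assms by (intro power_le_one) (auto simp: divide_le_eq)
  hence "(tanh x / x) ^ n * (tanh x ^ (m - n) * (1 / cosh x)) \<le> tanh x ^ (m - n) * (1 / cosh x)"
    using t by (intro mult_left_le_one_le) auto
  moreover have "tanh x ^ m = tanh x ^ n * tanh x ^ (m - n)"
    using assms by (simp add: power_add[symmetric])
  ultimately show "tanh x ^ m / (x ^ n * cosh x) \<le> tanh x ^ (m - n) * (1 / cosh x)"
    by (simp add: power_divide)
qed

lemma continuous_on_tanh_power_over:
  "continuous_on {0<..} (\<lambda>x::real. tanh x ^ m / (x ^ n * cosh x))"
proof -
  have nz: "cosh x \<noteq> 0" for x :: real using cosh_real_pos[of x] by linarith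
  show ?thesis using nz by (intro continuous_intros) auto
qed

lemma set_integrable_tanh_power_over:
  assumes "n \<le> m"
  shows "set_integrable lborel {0<..} (\<lambda>x::real. tanh x ^ m / (x ^ n * cosh x))"
proof (rule set_integrable_Ioi_continuous_bound[OF set_integrable_sech continuous_on_tanh_power_over])
  fix x :: real assume x: "x > 0"
  have "tanh x ^ (m - n) \<le> 1"
    using x tanh_real_lt_1[of x] by (intro power_le_one) auto
  hence "tanh x ^ (m - n) * (1 / cosh x) \<le> 1 / cosh x"
    using x by (intro mult_left_le_one_le) auto
  thus "\<bar>tanh x ^ m / (x ^ n * cosh x)\<bar> \<le> 1 / cosh x"
    using tanh_power_bound[OF assms x] by linarith
qed

text \<open>The derivative of tanh^m x / (x^n cosh x) is integrated. The condition n < m makes the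
  boundary value at 0 vanish and keeps all three integrals within the range where the power of x
  does not exceed that of tanh.\<close>

lemma LBINT_tanh_power_over_Suc:
  assumes "n < m"
  shows "real n * (LBINT x:{0<..}. tanh x ^ m / (x ^ Suc n * cosh x)) =
     real m * (LBINT x:{0<..}. tanh x ^ (m - 1) / (x ^ n * cosh x)) -
     real (Suc m) * (LBINT x:{0<..}. tanh x ^ Suc m / (x ^ n * cosh x))"
proof -
  define T where "T m n x = tanh x ^ m / (x ^ n * cosh x)" for m n and x :: real
  define f where "f x = real m * T (m - 1) n x - real (Suc m) * T (Suc m) n x - real n * T m (Suc n) x" for x
  have int: "set_integrable lborel {0<..} (T m' n')" if "n' \<le> m'" for m' n'
    using set_integrable_tanh_power_over[OF that] by (simp add: T_def[abs_def])
  have ints: "set_integrable lborel {0<..} (\<lambda>x. real m * T (m - 1) n x)"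
      "set_integrable lborel {0<..} (\<lambda>x. real (Suc m) * T (Suc m) n x)"
      "set_integrable lborel {0<..} (\<lambda>x. real n * T m (Suc n) x)"
    using assms by (intro set_integrable_mult_right int; simp)+
  have D: "(T m n has_field_derivative f x) (at x)" if "x > 0" for x
  proof -
    have "((\<lambda>x. inverse (x ^ n) * (tanh x ^ m / cosh x)) has_field_derivative
       - (real n * inverse (x ^ Suc n)) * (tanh x ^ m / cosh x) +
       (real m * (tanh x ^ (m - 1) / cosh x) - real (Suc m) * (tanh x ^ Suc m / cosh x)) * inverse (x ^ n)) (at x)"
    proof (rule DERIV_mult[OF _ has_field_derivative_tanh_power_over_cosh])
      have "((\<lambda>x. inverse (x ^ n)) has_field_derivative
           - (real n * (1 * x ^ (n - Suc 0)) * inverse ((x ^ n) ^ Suc (Suc 0)))) (at x)"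
        using that by (intro DERIV_inverse_fun[THEN DERIV_cong] DERIV_power DERIV_ident) auto
      also have "- (real n * (1 * x ^ (n - Suc 0)) * inverse ((x ^ n) ^ Suc (Suc 0))) = - (real n * inverse (x ^ Suc n))"
        using that by (cases n) (auto simp: field_simps)
      finally show "((\<lambda>x. inverse (x ^ n)) has_field_derivative - (real n * inverse (x ^ Suc n))) (at x)" .
    qed
    thus ?thesis
      by (rule has_field_derivative_transform_within_open[where S = UNIV, THEN DERIV_cong])
         (auto simp: T_def f_def divide_inverse algebra_simps)
  qed
  have lim0: "(T m n \<longlongrightarrow> 0) (at_right 0)"
  proof (rule tendsto_sandwich[OF _ _ tendsto_const])
    show "eventually (\<lambda>x. 0 \<le> T m n x) (at_right 0)"
      using tanh_power_bound(1)[of n m] assms by (auto simp: T_def eventually_at_filter intro!: always_eventually)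
    show "eventually (\<lambda>x. T m n x \<le> tanh x ^ (m - n) * (1 / cosh x)) (at_right 0)"
      using tanh_power_bound(2)[of n m] assms by (auto simp: T_def eventually_at_filter intro!: always_eventually)
    show "((\<lambda>x. tanh x ^ (m - n) * (1 / cosh x)) \<longlongrightarrow> (0::real)) (at_right 0)"
      using assms by (auto intro!: tendsto_eq_intros)
  qed
  have lim_inf: "(T m n \<longlongrightarrow> 0) at_top"
  proof (rule tendsto_sandwich[OF _ _ tendsto_const])
    show "eventually (\<lambda>x. 0 \<le> T m n x) at_top"
      using eventually_gt_at_top[of 0] by eventually_elim (use tanh_power_bound(1)[of n m] assms in \<open>auto simp: T_def\<close>)
    show "eventually (\<lambda>x. T m n x \<le> tanh x ^ (m - n) * (1 / cosh x)) at_top"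
      using eventually_gt_at_top[of 0] by eventually_elim (use tanh_power_bound(2)[of n m] assms in \<open>auto simp: T_def\<close>)
    have "((\<lambda>x. tanh x ^ (m - n) * inverse (cosh x)) \<longlongrightarrow> (1::real) ^ (m - n) * 0) at_top"
      by (intro tendsto_intros tanh_real_at_top tendsto_inverse_0_at_top cosh_real_at_top)
    thus "((\<lambda>x. tanh x ^ (m - n) * (1 / cosh x)) \<longlongrightarrow> (0::real)) at_top"
      by (simp add: inverse_eq_divide)
  qed
  have "(LBINT x:{0<..}. f x) = 0 - 0"
  proof (rule LBINT_FTC_0_infty[OF D _ _ lim0 lim_inf])
    show "set_integrable lborel {0<..} f"
      unfolding f_def[abs_def] by (intro set_integral_diff ints)
    have "continuous_on {0<..} f"
      unfolding f_def[abs_def] T_def by (intro continuous_intros continuous_on_tanh_power_over)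
    thus "isCont f x" if "x > 0" for x
      using that by (simp add: continuous_on_eq_continuous_at)
  qed
  moreover have "(LBINT x:{0<..}. f x) = real m * (LBINT x:{0<..}. T (m - 1) n x)
      - real (Suc m) * (LBINT x:{0<..}. T (Suc m) n x) - real n * (LBINT x:{0<..}. T m (Suc n) x)"
    unfolding f_def using ints by (simp only: set_integral_diff set_integral_mult_right)
  ultimately show ?thesis unfolding T_def by linarith
qed

lemma U_beta_conv_coeff_pairing: "U_beta = coeff_pairing b_val"
  by (simp add: fun_eq_iff U_beta_def coeff_pairing_def)

text \<open>The factor 2^(r+1) of each integral meets the 2^(-r) from q_m(D/2), leaving 2 for every
  r. The sign (-1)^m = -1 is the sign of -B.\<close>

lemma LBINT_tanh_power_over_1:
  assumes "odd m"
  shows "(LBINT x:{0<..}. tanh x ^ m / (x * cosh x)) = 2 * U_beta (- [:0, 1:] * q_poly m)"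
proof -
  define a where "a r = coeff (q_poly m) r / 2 ^ r" for r
  have odd: "odd r" if "a r \<noteq> 0" for r
    using coeff_q_poly_eq_0[of m r] that assms by (auto simp: a_def)
  \<comment> \<open>\<open>set_integrable_mult_right\<close> requires integrability only for a
    nonzero factor, and a nonzero \<open>a r\<close> forces r to be odd.\<close>
  have int: "set_integrable lborel {0<..} (\<lambda>x. a r * (sech_deriv r x / x))" for r
    by (intro set_integrable_mult_right set_integrable_sech_deriv odd)
  have summand: "(LBINT x:{0<..}. a r * (sech_deriv r x / x)) = 2 * (coeff (q_poly m) r * b_val (Suc r))" for r
  proof (cases "a r = 0")
    case True
    hence "coeff (q_poly m) r = 0" by (simp add: a_def)
    thus ?thesis using True by simp
  next
    case False
    show ?thesis
      by (simp only: set_integral_mult_right LBINT_sech_deriv[OF odd[OF False]]) (simp add: a_def)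
  qed
  have "(LBINT x:{0<..}. tanh x ^ m / (x * cosh x)) =
        (LBINT x:{0<..}. - (\<Sum>r\<le>degree (q_poly m). a r * (sech_deriv r x / x)))"
  proof (intro set_lebesgue_integral_cong)
    show "\<forall>x. x \<in> {0<..} \<longrightarrow> tanh x ^ m / (x * cosh x) = - (\<Sum>r\<le>degree (q_poly m). a r * (sech_deriv r x / x))"
    proof safe
      fix x :: real
      have "(\<Sum>r\<le>degree (q_poly m). a r * (sech_deriv r x / x)) =
            coeff_pairing (\<lambda>r. sech_deriv r x / 2 ^ r) (q_poly m) / x"
        by (simp add: coeff_pairing_def a_def sum_divide_distrib mult.commute)
      thus "tanh x ^ m / (x * cosh x) = - (\<Sum>r\<le>degree (q_poly m). a r * (sech_deriv r x / x))"
        using assms by (simp add: coeff_pairing_sech_deriv_q_poly mult.commute)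
    qed
  qed simp
  also have "\<dots> = - (\<Sum>r\<le>degree (q_poly m). LBINT x:{0<..}. a r * (sech_deriv r x / x))"
    using int unfolding set_lebesgue_integral_def set_integrable_def
    by (simp only: scaleR_minus_right scaleR_sum_right integral_minus Bochner_Integration.integral_sum)
  also have "\<dots> = - (\<Sum>r\<le>degree (q_poly m). 2 * (coeff (q_poly m) r * b_val (Suc r)))"
    by (simp only: summand)
  also have "(\<Sum>r\<le>degree (q_poly m). 2 * (coeff (q_poly m) r * b_val (Suc r))) =
      2 * coeff_pairing b_val (pCons 0 (q_poly m))"
    unfolding coeff_pairing_pCons_0 unfolding coeff_pairing_def by (rule sum_distrib_left[symmetric])
  also have "- (2 * coeff_pairing b_val (pCons 0 (q_poly m))) = 2 * U_beta (smult (- 1) (pCons 0 (q_poly m)))"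
    by (simp only: U_beta_conv_coeff_pairing coeff_pairing_smult)
  also have "smult (- 1) (pCons 0 (q_poly m)) = - [:0, 1:] * q_poly m" by simp
  finally show ?thesis .
qed

text \<open>The counterpart of the integration by parts: the recurrence for q_m times (-B)^n, where
  the extra factor -B turns 2 B q_m into the combination with the right sign.\<close>

lemma U_beta_q_poly_Suc:
  "2 * U_beta ((- [:0, 1:]) ^ Suc n * q_poly m) =
     real m * U_beta ((- [:0, 1:]) ^ n * q_poly (m - 1)) -
     real (Suc m) * U_beta ((- [:0, 1:]) ^ n * q_poly (Suc m))"
proof -
  define B where "B = (- [:0, 1:] :: real poly) ^ n"
  have distr: "smult a (B * p) + smult 2 (- Y * B * r) = B * (smult a p - smult 2 (Y * r))"
    for a and p r Y :: "real poly"
    by (simp add: algebra_simps)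
  have X: "[:0, 1:] * p = pCons 0 p" for p :: "real poly" by simp
  have "smult (real (Suc m)) (B * q_poly (Suc m)) + smult 2 ((- [:0, 1:]) ^ Suc n * q_poly m) =
      B * (smult (real (Suc m)) (q_poly (Suc m)) - smult 2 ([:0, 1:] * q_poly m))"
    unfolding power_Suc B_def[symmetric] by (rule distr)
  also have "\<dots> = smult (real m) (B * q_poly (m - 1))"
    unfolding q_poly_Suc X by (simp del: mult_pCons_left mult_pCons_right)
  finally have "U_beta (smult (real (Suc m)) (B * q_poly (Suc m)) + smult 2 ((- [:0, 1:]) ^ Suc n * q_poly m)) =
      U_beta (smult (real m) (B * q_poly (m - 1)))"
    by (rule arg_cong)
  thus ?thesis unfolding U_beta_add U_beta_smult B_def by linarith
qed

text \<open>The step from n to n + 1 uses the claim for n at m - 1 and m + 1, hence m is arbitrary.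
  Both keep the parity condition, and n + 1 <= m gives n <= m - 1.\<close>

lemma LBINT_tanh_power_over:
  assumes "1 \<le> n" "n \<le> m" "even (m + n)"
  shows "(LBINT x:{0<..}. tanh x ^ m / (x ^ n * cosh x)) =
     2 ^ n / fact (n - 1) * U_beta ((- [:0, 1:]) ^ n * q_poly m)"
  using assms
proof (induction n arbitrary: m rule: nat_induct_at_least)
  case base
  thus ?case using LBINT_tanh_power_over_1[of m] by simp
next
  case (Suc n)
  have "real n * (LBINT x:{0<..}. tanh x ^ m / (x ^ Suc n * cosh x)) =
      2 ^ n / fact (n - 1) * (real m * U_beta ((- [:0, 1:]) ^ n * q_poly (m - 1)) -
     real (Suc m) * U_beta ((- [:0, 1:]) ^ n * q_poly (Suc m)))"
    using Suc.prems Suc.hyps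
    by (subst LBINT_tanh_power_over_Suc, simp, subst (1 2) Suc.IH)
       (auto simp only: right_diff_distrib mult.left_commute, auto)
  also have "\<dots> = 2 ^ Suc n / fact (n - 1) * U_beta ((- [:0, 1:]) ^ Suc n * q_poly m)"
    unfolding U_beta_q_poly_Suc[symmetric] by (simp only: power_Suc) simp
  \<comment> \<open>Both sides of the recurrence carry the factor n, which turns (n-1)! into n! on
    cancellation.\<close>
  also have "\<dots> = real n * (2 ^ Suc n / fact (Suc n - 1) * U_beta ((- [:0, 1:]) ^ Suc n * q_poly m))"
    using Suc.hyps by (cases n) (simp_all del: power_Suc)
  finally show ?case using Suc.hyps by (simp only: mult_cancel_left) auto
qed

theorem theorem6p4:
  fixes m n :: nat
  assumes "1 \<le> n" and "n \<le> m" and "even (m + n)"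
  shows "((\<lambda>x::real. tanh x ^ m / (x ^ n * cosh x)) has_integral
           2 ^ n / fact (n - 1) * U_beta ((- [:0, 1:]) ^ n * q_poly m)) {0<..}"
  \<comment> \<open>Absolute integrability transfers the Lebesgue value to the gauge
    integral.\<close>
  using set_borel_integral_eq_integral[OF set_integrable_tanh_power_over[OF assms(2)]]
    LBINT_tanh_power_over[OF assms]
  by (simp add: has_integral_iff)

end
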